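(* Let $n\ge4$ and let $S$ be an inductive strategy of length $n$ with $S\neq CSL$, i.e. $S[n]\neq[n,1,2,\dots,n-1]$. Then $[x^3]f_{CSL}(x)<[x^3]f_S(x)$.
   Context: Permutation wordle on $[n]=\{1,\dots,n\}$: a secret permutation $\pi\in S_n$ (one-line notation) is fixed. The first guess is $\gamma_1=[1,2,\dots,n]$. After guess $\gamma_r$ the guesser learns $\mathcal{J}_r=\{i:\gamma_r(i)=\pi(i)\}$; $\mathcal{I}_r=[n]\setminus\mathcal{J}_r$. The game ends at the first $r$ with $\mathcal{J}_r=[n]$. A strategy of length $n$ is a sequence $S=(S[1],\dots,S[n])$ with $S[k]$ a permutation of $[k]$; if $\mathcal{I}_r=\{i_1<\dots<i_k\}\neq\emptyset$ and $\sigma=S[k]$, then $\gamma_{r+1}(i)=\gamma_r(i)$ for $i\in\mathcal{J}_r$ and $\gamma_{r+1}(i_{\sigma(j)})=\gamma_r(i_j)$ for $j=1,\dots,k$. $f_S(x)=\sum_r a_rx^r$ where $a_r$ is the number of $\pi\in S_n$ for which the game with $S$ ends after exactly $r$ guesses. The cyclic shift strategy $CS$ has $CS[k]=[2,3,\dots,k,1]$. An inductive strategy of length $n$ has $S[k]=CS[k]$ for $1\le k\le n-1$ and $S[n]$ an arbitrary cyclic permutation (single $n$-cycle) of $[n]$. $CSL$ denotes the inductive strategy of length $n$ with $CSL[n]=[n,1,2,\dots,n-1]$. *)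

theory Defs
  imports "HOL-Combinatorics.Combinatorics" "HOL-Computational_Algebra.Formal_Power_Series"
begin

text \<open>
  A permutation of $[k]$ is a function on nat with \<^term>\<open>\<sigma> permutes {1..k}\<close>, so it is the
  identity outside $[k]$; the value at i is entry i of the one-line notation.
  A strategy maps k to the permutation $S[k]$; for a strategy of length n only the
  arguments k = 1, ..., n are relevant.
\<close>

type_synonym strategy = "nat \<Rightarrow> nat \<Rightarrow> nat"

definition is_strategy :: "nat \<Rightarrow> strategy \<Rightarrow> bool" where
  "is_strategy n S \<longleftrightarrow> (\<forall>k\<in>{1..n}. S k permutes {1..k})"

definition incorrect :: "nat \<Rightarrow> (nat \<Rightarrow> nat) \<Rightarrow> (nat \<Rightarrow> nat) \<Rightarrow> nat set" where
  "incorrect n \<pi> \<gamma> = {i\<in>{1..n}. \<gamma> i \<noteq> \<pi> i}"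

text \<open>\<^term>\<open>nth_elem I j\<close> is $i_j$ where $I = \{i_1 < \dots < i_k\}$ (1-based).\<close>

definition nth_elem :: "nat set \<Rightarrow> nat \<Rightarrow> nat" where
  "nth_elem I j = sorted_list_of_set I ! (j - 1)"

text \<open>
  For i in I, the inverse picks the j with $i = i_{\sigma(j)}$; the lemma
  \<open>next_guess_at_incorrect\<close> below is the update rule in its usual form.
\<close>

definition next_guess :: "nat \<Rightarrow> strategy \<Rightarrow> (nat \<Rightarrow> nat) \<Rightarrow> (nat \<Rightarrow> nat) \<Rightarrow> nat \<Rightarrow> nat" where
  "next_guess n S \<pi> \<gamma> = (\<lambda>i.
     let I = incorrect n \<pi> \<gamma>; k = card I; \<sigma> = S k in
     if i \<in> I then \<gamma> (nth_elem I (inv_into {1..k} (\<lambda>j. nth_elem I (\<sigma> j)) i)) else \<gamma> i)"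

text \<open>Guesses are numbered from 1. After the game has ended the guess stays constant.\<close>

definition guess :: "nat \<Rightarrow> strategy \<Rightarrow> (nat \<Rightarrow> nat) \<Rightarrow> nat \<Rightarrow> nat \<Rightarrow> nat" where
  "guess n S \<pi> r = (next_guess n S \<pi> ^^ (r - 1)) id"

definition ends_after :: "nat \<Rightarrow> strategy \<Rightarrow> (nat \<Rightarrow> nat) \<Rightarrow> nat \<Rightarrow> bool" where
  "ends_after n S \<pi> r \<longleftrightarrow> r \<ge> 1 \<and> incorrect n \<pi> (guess n S \<pi> r) = {} \<and>
     (\<forall>s\<in>{1..<r}. incorrect n \<pi> (guess n S \<pi> s) \<noteq> {})"

definition wordle_gf :: "nat \<Rightarrow> strategy \<Rightarrow> nat fps" where
  "wordle_gf n S = Abs_fps (\<lambda>r. card {\<pi>. \<pi> permutes {1..n} \<and> ends_after n S \<pi> r})"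

definition CS :: strategy where
  "CS k = (\<lambda>i. if i \<in> {1..k} then (if i = k then 1 else i + 1) else i)"

definition inductive_strategy :: "nat \<Rightarrow> strategy \<Rightarrow> bool" where
  "inductive_strategy n S \<longleftrightarrow> is_strategy n S \<and>
     (\<forall>k\<in>{1..<n}. S k = CS k) \<and> cyclic_on (S n) {1..n}"

definition CSL :: "nat \<Rightarrow> strategy" where
  "CSL n = CS(n := (\<lambda>i. if i \<in> {1..n} then (if i = 1 then n else i - 1) else i))"

lemma nth_elem_bij_betw:
  assumes "finite I"
  shows "bij_betw (nth_elem I) {1..card I} I"
proof -
  have "bij_betw (\<lambda>j. j - 1) {1..card I} {..<card I}"
    by (rule bij_betw_byWitness[where f' = Suc]) auto
  moreover have "bij_betw (\<lambda>j. sorted_list_of_set I ! j) {..<card I} I"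
    using assms by (intro bij_betw_nth) auto
  ultimately have "bij_betw ((\<lambda>j. sorted_list_of_set I ! j) \<circ> (\<lambda>j. j - 1)) {1..card I} I"
    by (rule bij_betw_trans)
  then show ?thesis
    by (simp add: nth_elem_def[abs_def] comp_def)
qed

lemma next_guess_at_incorrect:
  fixes n :: nat and S :: strategy and \<pi> \<gamma> :: "nat \<Rightarrow> nat"
  defines "I \<equiv> incorrect n \<pi> \<gamma>"
  assumes S: "is_strategy n S" and j: "j \<in> {1..card I}"
  shows "next_guess n S \<pi> \<gamma> (nth_elem I (S (card I) j)) = \<gamma> (nth_elem I j)"
proof -
  have sub: "I \<subseteq> {1..n}"
    by (auto simp: I_def incorrect_def)
  then have fin: "finite I" and "card I \<le> n"
    using finite_subset card_mono[OF _ sub] by auto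
  with S j have "S (card I) permutes {1..card I}"
    by (auto simp: is_strategy_def)
  then have "bij_betw (S (card I)) {1..card I} {1..card I}"
    by (rule permutes_imp_bij)
  from bij_betw_trans[OF this nth_elem_bij_betw[OF fin]]
  have bij: "bij_betw (\<lambda>j. nth_elem I (S (card I) j)) {1..card I} I"
    by (simp add: comp_def)
  then have "nth_elem I (S (card I) j) \<in> I"
    using j by (auto dest: bij_betwE)
  moreover have "inv_into {1..card I} (\<lambda>j. nth_elem I (S (card I) j)) (nth_elem I (S (card I) j)) = j"
    using inv_into_f_f[OF bij_betw_imp_inj_on[OF bij] j] .
  ultimately show ?thesis
    by (simp add: next_guess_def Let_def flip: I_def)
qed

end

(*
  A secret with a fixed point is never played with S[n], so S and CSL behave alike on it.
  For a derangement the second guess is the inverse of S[n], and if the third guess is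
  correct, the secret is determined by the set I of positions that are wrong in the second
  guess: it is the inverse of e_I o S[n], where e_I is the shift S[|I|] transported to I.
  Hence one counts the sets I, |I| >= 2, for which e_I o S[n] has no fixed point.

  Every I that contains no two consecutive elements of the n-cycle S[n] qualifies, and so
  does I = [n]. For CSL there are no others, because e_I maps j to j+1 when both lie in I.
  Since all n-cycles are conjugate, CSL attains the minimum. If S[n] differs from CSL[n],
  there are j < n and y different from j+1 with S[n](y) = j, and {j, j+1, y} is an
  additional set.
*)

theory Submission
  imports Defs
begin

section \<open>Transporting a permutation of [k] to a set of size k\<close>

text \<open>The conjugate of \<open>\<sigma>\<close> under the increasing enumeration of
  \<open>I\<close>. The identity outside \<open>I\<close> lets it be composed with permutations of
  all positions.\<close>

definition relabel :: "(nat \<Rightarrow> nat) \<Rightarrow> nat set \<Rightarrow> nat \<Rightarrow> nat" where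
  "relabel \<sigma> I i =
     (if i \<in> I then nth_elem I (\<sigma> (inv_into {1..card I} (nth_elem I) i)) else i)"

lemma relabel_outside: "i \<notin> I \<Longrightarrow> relabel \<sigma> I i = i"
  by (simp add: relabel_def)

lemma relabel_nth_elem:
  assumes "finite I" "j \<in> {1..card I}"
  shows "relabel \<sigma> I (nth_elem I j) = nth_elem I (\<sigma> j)"
proof -
  note bij = nth_elem_bij_betw[OF assms(1)]
  have "nth_elem I j \<in> I"
    using bij_betwE[OF bij] assms(2) by blast
  moreover have "inv_into {1..card I} (nth_elem I) (nth_elem I j) = j"
    using inv_into_f_f[OF bij_betw_imp_inj_on[OF bij] assms(2)] .
  ultimately show ?thesis
    by (simp add: relabel_def)
qed

lemma nth_elem_cases:
  assumes "finite I" "i \<in> I"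
  obtains j where "j \<in> {1..card I}" "i = nth_elem I j"
  using bij_betw_imp_surj_on[OF nth_elem_bij_betw[OF assms(1)]] assms(2) by blast

lemma nth_elem_strict_mono:
  assumes "finite I" "i \<in> {1..card I}" "j \<in> {1..card I}" "i < j"
  shows "nth_elem I i < nth_elem I j"
  unfolding nth_elem_def using assms
  by (intro sorted_wrt_nth_less[OF strict_sorted_list_of_set]) auto

lemma nth_elem_less_iff:
  assumes "finite I" "i \<in> {1..card I}" "j \<in> {1..card I}"
  shows "nth_elem I i < nth_elem I j \<longleftrightarrow> i < j"
  using nth_elem_strict_mono[OF assms] nth_elem_strict_mono[OF assms(1,3,2)]
  by (metis linorder_neqE_nat order_less_asym)

lemma relabel_permutes:
  assumes "finite I" "\<sigma> permutes {1..card I}"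
  shows "relabel \<sigma> I permutes I"
proof (rule bij_imp_permutes)
  note bij = nth_elem_bij_betw[OF assms(1)]
  have "bij_betw (nth_elem I \<circ> \<sigma> \<circ> inv_into {1..card I} (nth_elem I)) I I"
    using bij bij_betw_inv_into[OF bij] permutes_imp_bij[OF assms(2)]
    by (blast intro: bij_betw_trans)
  then show "bij_betw (relabel \<sigma> I) I I"
    by (rule bij_betw_cong[THEN iffD1, rotated]) (simp add: relabel_def)
qed (rule relabel_outside)

lemma relabel_neq:
  assumes "finite I" "\<sigma> permutes {1..card I}" "\<And>j. j \<in> {1..card I} \<Longrightarrow> \<sigma> j \<noteq> j" "i \<in> I"
  shows "relabel \<sigma> I i \<noteq> i"
proof -
  obtain j where j: "j \<in> {1..card I}" "i = nth_elem I j"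
    using assms(1,4) by (rule nth_elem_cases)
  have "\<sigma> j \<in> {1..card I}"
    using j(1) permutes_in_image[OF assms(2)] by blast
  then have "nth_elem I (\<sigma> j) \<noteq> nth_elem I j"
    using inj_onD[OF bij_betw_imp_inj_on[OF nth_elem_bij_betw[OF assms(1)]]] j(1) assms(3)[OF j(1)]
    by blast
  then show ?thesis
    using relabel_nth_elem[OF assms(1) j(1)] j(2) by simp
qed

lemma nth_elem_interval: "j \<in> {1..n} \<Longrightarrow> nth_elem {1..n} j = j"
  unfolding nth_elem_def
  by (simp add: sorted_list_of_set_range atLeastLessThanSuc_atLeastAtMost[symmetric]
      del: upt_Suc)

lemma relabel_interval:
  assumes "\<sigma> permutes {1..n}"
  shows "relabel \<sigma> {1..n} = \<sigma>"
proof
  fix i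
  show "relabel \<sigma> {1..n} i = \<sigma> i"
  proof (cases "i \<in> {1..n}")
    case True
    then have "\<sigma> i \<in> {1..n}"
      using permutes_in_image[OF assms] by blast
    then show ?thesis
      using relabel_nth_elem[of "{1..n}" i \<sigma>] True nth_elem_interval by simp
  next
    case False
    then show ?thesis
      using assms by (simp add: relabel_outside permutes_not_in)
  qed
qed

text \<open>Nothing lies strictly between \<open>j\<close> and \<open>Suc j\<close>, so their ranks
  in \<open>I\<close> are consecutive, and \<open>CS\<close> raises a rank by one.\<close>

lemma relabel_CS_Suc:
  assumes "finite I" "j \<in> I" "Suc j \<in> I"
  shows "relabel (CS (card I)) I j = Suc j"
proof -
  obtain a where a: "a \<in> {1..card I}" "j = nth_elem I a"
    using assms(1,2) by (rule nth_elem_cases)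
  obtain b where b: "b \<in> {1..card I}" "Suc j = nth_elem I b"
    using assms(1,3) by (rule nth_elem_cases)
  have "a < b"
    using nth_elem_less_iff[OF assms(1) a(1) b(1)] a(2) b(2) by simp
  have "b = Suc a"
  proof (rule ccontr)
    assume "b \<noteq> Suc a"
    with \<open>a < b\<close> have "Suc a < b" by simp
    moreover have "Suc a \<in> {1..card I}"
      using b(1) \<open>Suc a < b\<close> by auto
    ultimately show False
      using nth_elem_strict_mono[OF assms(1) _ b(1)] nth_elem_strict_mono[OF assms(1) a(1)]
        a(2) b(2) by fastforce
  qed
  then show ?thesis
    using relabel_nth_elem[OF assms(1) a(1), of "CS (card I)"] a b by (auto simp: CS_def)
qed

text \<open>As the maximum and the minimum of \<open>I\<close>, the elements \<open>n\<close> and 1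
  have ranks \<open>card I\<close> and 1, and \<open>CS\<close> sends the last rank to the
  first.\<close>

lemma relabel_CS_wrap:
  assumes "I \<subseteq> {1..n}" "n \<in> I" "1 \<in> I"
  shows "relabel (CS (card I)) I n = 1"
proof -
  have fin: "finite I"
    using assms(1) finite_subset by blast
  have range: "nth_elem I j \<in> {1..n}" if "j \<in> {1..card I}" for j
    using bij_betwE[OF nth_elem_bij_betw[OF fin]] that assms(1) by blast
  obtain a where a: "a \<in> {1..card I}" "n = nth_elem I a"
    using fin assms(2) by (rule nth_elem_cases)
  obtain b where b: "b \<in> {1..card I}" "1 = nth_elem I b"
    using fin assms(3) by (rule nth_elem_cases)
  have "a = card I"
  proof (rule ccontr)
    assume "a \<noteq> card I"
    with a(1) have k: "card I \<in> {1..card I}" "a < card I" by auto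
    show False
      using nth_elem_strict_mono[OF fin a(1) k] range[OF k(1)] a(2) by simp
  qed
  moreover have "b = 1"
  proof (rule ccontr)
    assume "b \<noteq> 1"
    with b(1) have k: "1 \<in> {1..card I}" "1 < b" by auto
    show False
      using nth_elem_strict_mono[OF fin k(1) b(1) k(2)] range[OF k(1)] b(2) by simp
  qed
  ultimately show ?thesis
    using relabel_nth_elem[OF fin a(1), of "CS (card I)"] a b by (simp add: CS_def)
qed

lemma CS_permutes: "CS k permutes {1..k}"
proof (rule bij_imp_permutes)
  show "bij_betw (CS k) {1..k} {1..k}"
    by (rule bij_betw_byWitness[where f' = "\<lambda>i. if i = 1 then k else i - 1"])
      (auto simp: CS_def)
qed (simp add: CS_def del: atLeastAtMost_iff)

lemma CSL_permutes: "CSL n n permutes {1..n}"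
proof (rule bij_imp_permutes)
  show "bij_betw (CSL n n) {1..n} {1..n}"
    by (rule bij_betw_byWitness[where f' = "\<lambda>i. if i = n then 1 else i + 1"])
      (auto simp: CSL_def)
qed (simp add: CSL_def del: atLeastAtMost_iff)

section \<open>Games that end after three guesses\<close>

lemma incorrect_subset: "incorrect n \<pi> \<gamma> \<subseteq> {1..n}"
  by (auto simp: incorrect_def)

lemma finite_incorrect [simp]: "finite (incorrect n \<pi> \<gamma>)"
  using finite_subset[OF incorrect_subset] by blast

lemma incorrect_empty_iff:
  assumes "\<pi> permutes {1..n}" "\<gamma> permutes {1..n}"
  shows "incorrect n \<pi> \<gamma> = {} \<longleftrightarrow> \<pi> = \<gamma>"
proof
  assume "incorrect n \<pi> \<gamma> = {}"
  then have "\<pi> i = \<gamma> i" for i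
    using assms by (cases "i \<in> {1..n}") (auto simp: incorrect_def permutes_not_in)
  then show "\<pi> = \<gamma>" by blast
qed (simp add: incorrect_def)

lemma strategy_permutes_card: "is_strategy n S \<Longrightarrow> I \<subseteq> {1..n} \<Longrightarrow> I \<noteq> {} \<Longrightarrow> S (card I) permutes {1..card I}"
  using card_mono[of "{1..n}" I] finite_subset[of I "{1..n}"]
  by (auto simp: is_strategy_def card_gt_0_iff Suc_le_eq)

lemma relabel_strategy_permutes:
  assumes "is_strategy n S" "I \<subseteq> {1..n}"
  shows "relabel (S (card I)) I permutes I"
proof (cases "I = {}")
  \<comment> \<open>The value \<open>S 0\<close> is unconstrained, but on the empty set
    \<open>relabel\<close> is the identity whatever it is.\<close>
  case True
  then have "relabel (S (card I)) I = id"
    by (auto simp: relabel_def)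
  then show ?thesis
    by (simp add: permutes_id)
next
  case False
  have "finite I"
    using assms(2) finite_subset by blast
  then show ?thesis
    using strategy_permutes_card[OF assms False] by (rule relabel_permutes)
qed

text \<open>The value at position i moves to position e(i), where e is the relabelled move, so the
  guess is composed with the inverse of e. This turns the game into a product of
  permutations.\<close>

lemma next_guess_eq:
  fixes \<pi> \<gamma> :: "nat \<Rightarrow> nat"
  assumes S: "is_strategy n S"
  defines "I \<equiv> incorrect n \<pi> \<gamma>"
  shows "next_guess n S \<pi> \<gamma> = \<gamma> \<circ> inv (relabel (S (card I)) I)"
proof
  fix i
  have sub: "I \<subseteq> {1..n}" and fin: "finite I"
    unfolding I_def by (auto simp: incorrect_def)
  define e where "e = relabel (S (card I)) I"
  have e: "e permutes I"
    unfolding e_def using relabel_strategy_permutes[OF S sub] .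
  show "next_guess n S \<pi> \<gamma> i = (\<gamma> \<circ> inv (relabel (S (card I)) I)) i"
  proof (cases "i \<in> I")
    case False
    then have "inv e i = i"
      using permutes_not_in[OF permutes_inv[OF e]] by blast
    then show ?thesis
      using False by (simp add: next_guess_def Let_def e_def flip: I_def)
  next
    case True
    then obtain i' where i': "i' \<in> I" "i = e i'"
      using permutes_image[OF e] by blast
    obtain j where j: "j \<in> {1..card I}" "i' = nth_elem I j"
      using fin i'(1) by (rule nth_elem_cases)
    have i: "i = nth_elem I (S (card I) j)"
      using relabel_nth_elem[OF fin j(1)] i'(2) j(2) by (simp add: e_def)
    have "next_guess n S \<pi> \<gamma> i = \<gamma> i'"
      using next_guess_at_incorrect[OF S, of j \<pi> \<gamma>] j i by (simp add: I_def)
    moreover have "inv e i = i'"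
      using i'(2) permutes_inverses(2)[OF e] by simp
    ultimately show ?thesis
      by (simp add: e_def)
  qed
qed

lemma ends_after_3:
  "ends_after n S \<pi> 3 \<longleftrightarrow>
     incorrect n \<pi> id \<noteq> {} \<and>
     incorrect n \<pi> (next_guess n S \<pi> id) \<noteq> {} \<and>
     incorrect n \<pi> (next_guess n S \<pi> (next_guess n S \<pi> id)) = {}"
proof -
  have "{1..<3} = {1, 2::nat}" by auto
  then show ?thesis
    by (auto simp: ends_after_def guess_def numeral_2_eq_2)
qed

section \<open>Secrets without fixed points\<close>

definition derangements :: "nat \<Rightarrow> (nat \<Rightarrow> nat) set" where
  "derangements n = {\<pi>. \<pi> permutes {1..n} \<and> (\<forall>i\<in>{1..n}. \<pi> i \<noteq> i)}"

text \<open>The possible sets of incorrect positions after the second guess, when the secret is a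
  derangement and the third guess is correct.\<close>

definition good_sets :: "nat \<Rightarrow> strategy \<Rightarrow> nat set set" where
  "good_sets n S = {I. I \<subseteq> {1..n} \<and> 2 \<le> card I \<and>
     (\<forall>i\<in>{1..n}. relabel (S (card I)) I (S n i) \<noteq> i)}"

text \<open>By injectivity of \<open>inv \<sigma>\<close> the two permutations disagree exactly
  where \<open>e\<close> moves a point, which is everywhere on \<open>I\<close> and nowhere else.
  Hence \<open>I\<close> can be recovered from the secret.\<close>

lemma incorrect_comp_inv:
  assumes "\<sigma> permutes {1..n}" "e permutes I" "I \<subseteq> {1..n}" "\<And>i. i \<in> I \<Longrightarrow> e i \<noteq> i"
  shows "incorrect n (inv \<sigma> \<circ> inv e) (inv \<sigma>) = I"
proof -
  have "inv \<sigma> i \<noteq> inv \<sigma> (inv e i) \<longleftrightarrow> i \<in> I" for i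
  proof -
    have "inv \<sigma> i = inv \<sigma> (inv e i) \<longleftrightarrow> i = inv e i"
      using permutes_inj[OF permutes_inv[OF assms(1)]] by (auto dest: injD)
    also have "\<dots> \<longleftrightarrow> e i = i"
      by (metis assms(2) permutes_inverses)
    also have "\<dots> \<longleftrightarrow> i \<notin> I"
      using assms(2,4) permutes_not_in by metis
    finally show ?thesis by blast
  qed
  then show ?thesis
    using assms(3) by (auto simp: incorrect_def)
qed

lemma card_derangements_ends_after_3:
  assumes S: "is_strategy n S" "\<And>k. k \<in> {1..<n} \<Longrightarrow> S k = CS k"
    and no_fix: "\<And>i. i \<in> {1..n} \<Longrightarrow> S n i \<noteq> i" and n: "n \<ge> 1"
  shows "card {\<pi> \<in> derangements n. ends_after n S \<pi> 3} = card (good_sets n S)"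
proof -
  \<comment> \<open>For a derangement this is the third guess when \<open>I\<close> is the set of
    positions wrong in the second. As the inverse of e_I o S[n], it has the same fixed points as e_I
    o S[n], so it is a derangement exactly under the last condition in
    \<open>good_sets\<close>.\<close>
  define secret where "secret = (\<lambda>I. inv (S n) \<circ> inv (relabel (S (card I)) I))"
  define e where "e = (\<lambda>I. relabel (S (card I)) I)"
  have e: "e I permutes I" if "I \<subseteq> {1..n}" for I
    unfolding e_def by (rule relabel_strategy_permutes[OF S(1) that])
  have e_neq: "e I i \<noteq> i" if "I \<subseteq> {1..n}" "2 \<le> card I" "i \<in> I" for I i
    unfolding e_def
  proof (rule relabel_neq)
    show "finite I" using that(1) finite_subset by blast
    show "S (card I) permutes {1..card I}"
      using strategy_permutes_card[OF S(1) that(1)] that(3) by blast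
    have "card I \<le> n" using card_mono[OF _ that(1)] by simp
    then show "S (card I) j \<noteq> j" if "j \<in> {1..card I}" for j
      using S(2)[of "card I"] no_fix that \<open>2 \<le> card I\<close>
      by (cases "card I = n") (auto simp: CS_def)
  qed (rule that(3))
  have secret_eq: "secret I = inv (S n) \<circ> inv (e I)" for I
    by (simp add: secret_def e_def)
  have perm: "S n permutes {1..n}"
    using S(1) n by (simp add: is_strategy_def)
  have secret_permutes: "secret I permutes {1..n}" if "I \<subseteq> {1..n}" for I
    unfolding secret_eq
    using permutes_compose[OF permutes_inv[OF permutes_subset[OF e[OF that] that]]
        permutes_inv[OF perm]] .
  have secret_fix: "secret I i = i \<longleftrightarrow> e I (S n i) = i" if "I \<subseteq> {1..n}" for I i
    unfolding secret_eq comp_apply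
    by (metis perm e[OF that] permutes_inverses)
  have secret_incorrect: "incorrect n (secret I) (inv (S n)) = I"
    if "I \<subseteq> {1..n}" "2 \<le> card I" for I
    unfolding secret_eq
    using incorrect_comp_inv[OF perm e[OF that(1)] that(1)] e_neq[OF that] by blast
  have step1: "next_guess n S \<pi> id = inv (S n)" if "\<pi> \<in> derangements n" for \<pi>
  proof -
    have "incorrect n \<pi> id = {1..n}"
      using that by (force simp: incorrect_def derangements_def)
    then show ?thesis
      using next_guess_eq[OF S(1), of \<pi> id] relabel_interval[OF perm] by simp
  qed
  have step2: "next_guess n S \<pi> (inv (S n)) = secret (incorrect n \<pi> (inv (S n)))" for \<pi>
    using next_guess_eq[OF S(1)] by (simp add: secret_def)
  have eq: "{\<pi> \<in> derangements n. ends_after n S \<pi> 3} = secret ` good_sets n S"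
  proof (intro equalityI subsetI)
    fix \<pi> assume "\<pi> \<in> {\<pi> \<in> derangements n. ends_after n S \<pi> 3}"
    then have der: "\<pi> \<in> derangements n" and ends: "ends_after n S \<pi> 3" by auto
    define I where "I = incorrect n \<pi> (inv (S n))"
    have I: "I \<subseteq> {1..n}" unfolding I_def by (rule incorrect_subset)
    have \<pi>: "\<pi> permutes {1..n}" using der by (simp add: derangements_def)
    have "I \<noteq> {}" "incorrect n \<pi> (secret I) = {}"
      using ends step1[OF der] step2 by (auto simp: ends_after_3 I_def)
    then have eq: "\<pi> = secret I"
      using incorrect_empty_iff[OF \<pi> secret_permutes[OF I]] by blast
    \<comment> \<open>With one wrong position e_I is the identity, so the third guess would repeat
      the second, which is wrong.\<close>
    have "card I \<noteq> 1"
    proof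
      assume "card I = 1"
      then obtain x where "I = {x}" by (auto simp: card_1_singleton_iff)
      then have "e I = id" using e[OF I] by simp
      then have "\<pi> = inv (S n)"
        using eq by (simp add: secret_eq)
      then show False
        using \<open>I \<noteq> {}\<close> by (simp add: I_def incorrect_def)
    qed
    moreover have "card I \<noteq> 0"
      using \<open>I \<noteq> {}\<close> by (simp add: I_def)
    ultimately have "2 \<le> card I" by linarith
    moreover have "e I (S n i) \<noteq> i" if "i \<in> {1..n}" for i
      using der that secret_fix[OF I] eq by (auto simp: derangements_def)
    ultimately have "I \<in> good_sets n S"
      using I by (simp add: good_sets_def e_def)
    then show "\<pi> \<in> secret ` good_sets n S"
      using eq by blast
  next
    fix \<pi> assume "\<pi> \<in> secret ` good_sets n S"
    then obtain I where I: "I \<subseteq> {1..n}" "2 \<le> card I" "\<And>i. i \<in> {1..n} \<Longrightarrow> e I (S n i) \<noteq> i"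
      and \<pi>: "\<pi> = secret I"
      by (auto simp: good_sets_def e_def)
    have der: "\<pi> \<in> derangements n"
      using secret_permutes[OF I(1)] secret_fix[OF I(1)] I(3) \<pi> by (auto simp: derangements_def)
    have "I \<noteq> {}" using I(2) by auto
    then have "incorrect n \<pi> id \<noteq> {}"
      using der I(1) by (force simp: incorrect_def derangements_def)
    moreover have "incorrect n \<pi> (inv (S n)) = I"
      unfolding \<pi> by (rule secret_incorrect[OF I(1,2)])
    moreover from this have "incorrect n \<pi> (next_guess n S \<pi> (inv (S n))) = {}"
      using step2 \<pi> by (simp add: incorrect_def)
    ultimately have "ends_after n S \<pi> 3"
      using \<open>I \<noteq> {}\<close> step1[OF der] by (simp add: ends_after_3)
    then show "\<pi> \<in> {\<pi> \<in> derangements n. ends_after n S \<pi> 3}"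
      using der by blast
  qed
  \<comment> \<open>The secret determines \<open>I\<close> as the set of positions where it differs
    from the second guess.\<close>
  have "inj_on secret (good_sets n S)"
    by (rule inj_on_inverseI[where g = "\<lambda>\<pi>. incorrect n \<pi> (inv (S n))"])
      (simp add: good_sets_def secret_incorrect)
  then show ?thesis
    unfolding eq by (rule card_image)
qed

section \<open>Secrets with a fixed point\<close>

lemma incorrect_next_guess_subset:
  "incorrect n \<pi> (next_guess n S \<pi> \<gamma>) \<subseteq> incorrect n \<pi> \<gamma>"
  by (auto simp: incorrect_def next_guess_def Let_def)

lemma next_guess_cong:
  assumes "\<And>k. k \<in> {1..<n} \<Longrightarrow> S k = T k" "incorrect n \<pi> \<gamma> \<noteq> {1..n}"
  shows "next_guess n S \<pi> \<gamma> = next_guess n T \<pi> \<gamma>"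
proof (cases "incorrect n \<pi> \<gamma> = {}")
  case True
  then show ?thesis by (simp add: next_guess_def)
next
  case False
  have "card (incorrect n \<pi> \<gamma>) < card {1..n}"
    using assms(2) incorrect_subset by (intro psubset_card_mono) auto
  then have "card (incorrect n \<pi> \<gamma>) \<in> {1..<n}"
    using False by (simp add: Suc_le_eq card_gt_0_iff)
  then have "S (card (incorrect n \<pi> \<gamma>)) = T (card (incorrect n \<pi> \<gamma>))"
    by (rule assms(1))
  then show ?thesis
    by (simp only: next_guess_def Let_def)
qed

text \<open>The set of wrong positions only shrinks, so once the first guess has a correct position,
  no later move acts on all \<open>n\<close> positions and the entry at \<open>n\<close> is never
  consulted.\<close>

lemma ends_after_3_cong:
  assumes "\<And>k. k \<in> {1..<n} \<Longrightarrow> S k = T k" "incorrect n \<pi> id \<noteq> {1..n}"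
  shows "ends_after n S \<pi> 3 \<longleftrightarrow> ends_after n T \<pi> 3"
proof -
  have "incorrect n \<pi> (next_guess n T \<pi> id) \<noteq> {1..n}"
    using assms(2) incorrect_next_guess_subset[of n \<pi> T id] incorrect_subset[of n \<pi> id] by blast
  then show ?thesis
    using next_guess_cong[of n S T, OF assms(1)] assms(2) by (simp add: ends_after_3)
qed

text \<open>The second summand does not mention \<open>S\<close>, so comparing two such strategies
  reduces to comparing their numbers of good sets.\<close>

lemma wordle_gf_3:
  assumes S: "is_strategy n S" "\<And>k. k \<in> {1..<n} \<Longrightarrow> S k = CS k"
    and no_fix: "\<And>i. i \<in> {1..n} \<Longrightarrow> S n i \<noteq> i" and n: "n \<ge> 1"
  shows "fps_nth (wordle_gf n S) 3 = card (good_sets n S) +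
    card {\<pi>. \<pi> permutes {1..n} \<and> \<pi> \<notin> derangements n \<and> ends_after n CS \<pi> 3}"
proof -
  have fin: "finite {\<pi>. \<pi> permutes {1..n} \<and> P \<pi>}" for P
    by (rule finite_subset[OF _ finite_permutations[of "{1..n}"]]) auto
  have "{\<pi>. \<pi> permutes {1..n} \<and> ends_after n S \<pi> 3} =
      {\<pi> \<in> derangements n. ends_after n S \<pi> 3} \<union>
      {\<pi>. \<pi> permutes {1..n} \<and> \<pi> \<notin> derangements n \<and> ends_after n S \<pi> 3}"
    by (auto simp: derangements_def)
  moreover have "{\<pi>. \<pi> permutes {1..n} \<and> \<pi> \<notin> derangements n \<and> ends_after n S \<pi> 3} =
      {\<pi>. \<pi> permutes {1..n} \<and> \<pi> \<notin> derangements n \<and> ends_after n CS \<pi> 3}"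
  proof -
    have "ends_after n S \<pi> 3 \<longleftrightarrow> ends_after n CS \<pi> 3"
      if \<pi>: "\<pi> permutes {1..n}" "\<pi> \<notin> derangements n" for \<pi>
    proof (rule ends_after_3_cong[OF S(2)])
      obtain i where "i \<in> {1..n}" "\<pi> i = i"
        using \<pi> unfolding derangements_def by blast
      then have "i \<in> {1..n} - incorrect n \<pi> id"
        by (simp add: incorrect_def)
      then show "incorrect n \<pi> id \<noteq> {1..n}" by blast
    qed auto
    then show ?thesis by blast
  qed
  moreover have "finite {\<pi> \<in> derangements n. ends_after n S \<pi> 3}"
    using fin by (rule finite_subset[rotated]) (auto simp: derangements_def)
  ultimately show ?thesis
    using fin card_derangements_ends_after_3[OF assms]
    by (simp add: wordle_gf_def card_Un_disjoint disjoint_iff)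
qed

section \<open>Comparing the good sets\<close>

text \<open>\<open>CSL n n\<close> inverts \<open>CS n\<close> on \<open>{1..n}\<close>. If
  \<open>j\<close> and \<open>CS n j\<close> both lay in a proper subset \<open>I\<close>, then e_I
  would map \<open>j\<close> to \<open>CS n j\<close>, making \<open>CS n j\<close> a fixed point of
  e_I o CSL[n].\<close>

lemma good_sets_CSL:
  assumes "I \<in> good_sets n (CSL n)" "I \<noteq> {1..n}" "j \<in> I"
  shows "CS n j \<notin> I"
proof
  assume CS: "CS n j \<in> I"
  have I: "I \<subseteq> {1..n}" using assms(1) by (simp add: good_sets_def)
  have fin: "finite I" using I finite_subset by blast
  have "card I < n"
    using psubset_card_mono[of "{1..n}" I] I assms(2) by auto
  then have good: "relabel (CS (card I)) I (CSL n n i) \<noteq> i" if "i \<in> {1..n}" for i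
    using assms(1) that by (simp add: good_sets_def CSL_def)
  have j: "j \<in> {1..n}" using I assms(3) by blast
  then have "CS n j \<in> {1..n}" "CSL n n (CS n j) = j"
    by (auto simp: CS_def CSL_def)
  then have "relabel (CS (card I)) I j \<noteq> CS n j"
    using good by force
  moreover have "relabel (CS (card I)) I j = CS n j"
  proof (cases "j = n")
    case True
    then show ?thesis
      using relabel_CS_wrap[OF I] assms(3) CS j by (simp add: CS_def)
  next
    case False
    then show ?thesis
      using relabel_CS_Suc[OF fin assms(3)] CS j by (simp add: CS_def)
  qed
  ultimately show False by blast
qed

text \<open>If \<open>S n i\<close> lies in \<open>I\<close>, then e_I keeps it in \<open>I\<close>
  while \<open>i\<close> is outside. Otherwise e_I leaves \<open>S n i\<close> alone, and it differs
  from \<open>i\<close>.\<close>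

lemma good_sets_independent:
  assumes "is_strategy n S" "I \<subseteq> {1..n}" "2 \<le> card I" "\<And>i. i \<in> I \<Longrightarrow> S n i \<notin> I"
    and "\<And>i. i \<in> {1..n} \<Longrightarrow> S n i \<noteq> i"
  shows "I \<in> good_sets n S"
proof -
  have e: "relabel (S (card I)) I permutes I"
    by (rule relabel_strategy_permutes[OF assms(1,2)])
  have "relabel (S (card I)) I (S n i) \<noteq> i" if "i \<in> {1..n}" for i
    using permutes_in_image[OF e, of "S n i"] relabel_outside[of "S n i" I] assms(4,5) that
    by (cases "S n i \<in> I") auto
  then show ?thesis
    using assms(2,3) by (simp add: good_sets_def)
qed

section \<open>Cyclic permutations of a finite set\<close>

lemma cyclic_on_bij_betw_funpow:
  assumes "cyclic_on f A" "x \<in> A"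
  shows "bij_betw (\<lambda>i. (f ^^ i) x) {..<card A} A" and "(f ^^ card A) x = x"
proof -
  have A: "A = orbit f x" and x: "x \<in> orbit f x"
    using assms by (auto simp: cyclic_on_alldef)
  \<comment> \<open>The first return time of \<open>x\<close>: the iterates before it are distinct
    and fill the orbit, so it equals \<open>card A\<close>.\<close>
  define m where "m = funpow_dist1 f x x"
  have inj: "inj_on (\<lambda>i. (f ^^ i) x) {..<m}"
    using inj_on_funpow_dist1[OF x] by (simp add: m_def atLeast0LessThan)
  moreover have im: "A = (\<lambda>i. (f ^^ i) x) ` {..<m}"
    using orbit_conv_funpow_dist1[OF x] A by (simp add: m_def atLeast0LessThan)
  ultimately have "card A = m"
    by (simp add: card_image)
  with inj im show "bij_betw (\<lambda>i. (f ^^ i) x) {..<card A} A"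
    by (simp add: bij_betw_def)
  show "(f ^^ card A) x = x"
    using funpow_dist1_prop[OF x] \<open>card A = m\<close> by (simp add: m_def)
qed

text \<open>Listing the cycle from 1 as 1, \<open>f 1\<close>, \<open>f (f 1)\<close>, ... turns an
  application of \<open>f\<close> into a step of the index; the step from \<open>n\<close> back to 1
  is correct because the \<open>n\<close>-th iterate fixes 1. The map \<open>h\<close> will carry
  independent sets of one cycle to those of the other.\<close>

lemma cyclic_on_conjugate_CS:
  assumes "cyclic_on f {1..n}" "n \<ge> 1"
  obtains h where "bij_betw h {1..n} {1..n}" "\<And>i. i \<in> {1..n} \<Longrightarrow> h (CS n i) = f (h i)"
proof
  define h where "h = (\<lambda>i. (f ^^ (i - 1)) 1)"
  have 1: "1 \<in> {1..n}" using assms(2) by simp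
  note pow = cyclic_on_bij_betw_funpow[OF assms(1) 1, simplified]
  have "bij_betw (\<lambda>i. i - 1) {1..n} {..<n}"
    by (rule bij_betw_byWitness[where f' = Suc]) auto
  from bij_betw_trans[OF this, OF pow(1)] show "bij_betw h {1..n} {1..n}"
    by (simp add: h_def comp_def)
  fix i assume i: "i \<in> {1..n}"
  then have "f (h i) = (f ^^ i) 1"
    unfolding h_def using funpow.simps(2)[of "i - 1" f] by simp
  then show "h (CS n i) = f (h i)"
    using i pow(2) by (auto simp: h_def CS_def)
qed

text \<open>If \<open>f (f x) = x\<close>, the orbit of \<open>x\<close> is \<open>{x, f x}\<close>,
  too small to be \<open>A\<close>; a fixed point is a special case.\<close>

lemma cyclic_on_no_short_cycle:
  assumes "cyclic_on f A" "x \<in> A" "card A \<ge> 3"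
  shows "f x \<noteq> x" "f (f x) \<noteq> x"
proof -
  have "A \<subseteq> {x, f x}" if "f (f x) = x"
  proof
    fix y assume "y \<in> A"
    then have "y \<in> orbit f x" using assms(1,2) by (auto simp: cyclic_on_alldef)
    then show "y \<in> {x, f x}" by induct (auto simp: that)
  qed
  moreover have "card {x, f x} \<le> 2" by (simp add: card_insert_if)
  ultimately show "f (f x) \<noteq> x"
    using assms(3) card_mono[of "{x, f x}" A] by fastforce
  then show "f x \<noteq> x" by auto
qed

text \<open>An independent set for the n-cycle \<open>S n\<close> is always good, but this good set is not
  independent, since it contains y together with \<open>S n y = j\<close>.\<close>

lemma good_sets_triple:
  assumes S: "is_strategy n S" "\<And>k. k \<in> {1..<n} \<Longrightarrow> S k = CS k"
    and no_fix: "\<And>i. i \<in> {1..n} \<Longrightarrow> S n i \<noteq> i"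
    and no_two: "\<And>i. i \<in> {1..n} \<Longrightarrow> S n (S n i) \<noteq> i"
    and n: "n \<ge> 4" and j: "j \<in> {1..<n}" and y: "y \<in> {1..n}" "S n y = j" "y \<noteq> Suc j"
  shows "{j, Suc j, y} \<in> good_sets n S" "card {j, Suc j, y} = 3"
proof -
  define I where "I = {j, Suc j, y}"
  have "y \<noteq> j" using no_fix y by blast
  then show card: "card {j, Suc j, y} = 3" using y(3) by auto
  have I: "I \<subseteq> {1..n}" using j y(1) by (auto simp: I_def)
  \<comment> \<open>Since 3 < \<open>n\<close>, the triple is played with the cyclic shift and not
    with S[n].\<close>
  have cs: "S (card I) = CS (card I)"
    using card S(2)[of "card I"] n by (simp add: I_def)
  define e where "e = relabel (S (card I)) I"
  have e: "e permutes I"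
    unfolding e_def by (rule relabel_strategy_permutes[OF S(1) I])
  have e_neq: "e i \<noteq> i" if "i \<in> I" for i
    unfolding e_def
    by (rule relabel_neq) (use that card CS_permutes[of 3] cs in \<open>auto simp: I_def CS_def\<close>)
  \<comment> \<open>A permutation of three points without fixed points that sends \<open>j\<close>
    to \<open>Suc j\<close> must be the 3-cycle \<open>j\<close>, \<open>Suc j\<close>,
    \<open>y\<close>, whatever the rank of \<open>y\<close> in the triple.\<close>
  have ej: "e j = Suc j"
    unfolding e_def cs by (rule relabel_CS_Suc) (auto simp: I_def)
  have e_in: "e (Suc j) \<in> I" "e y \<in> I"
    using permutes_in_image[OF e] by (auto simp: I_def)
  have inj: "e a = e b \<Longrightarrow> a = b" for a b
    using permutes_inj[OF e] by (auto dest: injD)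
  have ey: "e y = j"
    using e_in(2) inj[of y j] e_neq[of y] ej \<open>y \<noteq> j\<close> by (auto simp: I_def)
  have eSj: "e (Suc j) = y"
    using e_in(1) inj[of "Suc j" y] e_neq[of "Suc j"] ey y(3) by (auto simp: I_def)
  have "e (S n i) \<noteq> i" if i: "i \<in> {1..n}" for i
  proof
    assume *: "e (S n i) = i"
    show False
    proof (cases "S n i \<in> I")
      case False
      then show False
        using * no_fix[OF i] permutes_not_in[OF e] by simp
    next
      \<comment> \<open>If \<open>S n i\<close> is \<open>j\<close>, then \<open>i\<close> is
        \<open>y\<close>, but \<open>e j\<close> is \<open>Suc j\<close>. If it is
        \<open>Suc j\<close>, then \<open>i\<close> is \<open>e (Suc j) = y\<close>, against
        \<open>S n y = j\<close>. If it is \<open>y\<close>, then \<open>i\<close> is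
        \<open>e y = j\<close>, and \<open>j\<close> and \<open>y\<close> would form a 2-cycle of
        \<open>S n\<close>.\<close>
      case True
      have "S n permutes {1..n}" using S(1) n by (simp add: is_strategy_def)
      then have "i = y" if "S n i = j"
        using that y(2) permutes_inj[of "S n"] by (auto dest: injD)
      moreover have "\<not> (S n i = y \<and> i = j)"
        using y no_two[OF y(1)] no_two[of j] j by auto
      ultimately show False
        using True * ej ey eSj y by (auto simp: I_def)
    qed
  qed
  then show "{j, Suc j, y} \<in> good_sets n S"
    using I card unfolding I_def[symmetric] by (simp add: good_sets_def e_def)
qed

text \<open>If each \<open>j < n\<close> had only \<open>Suc j\<close> as preimage,
  \<open>\<sigma>\<close> would agree with CSL[n] on 2, ..., \<open>n\<close>, and \<open>n\<close>
  would be the only value left for 1.\<close>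

lemma exists_not_CSL:
  assumes "\<sigma> permutes {1..n}" "\<sigma> \<noteq> CSL n n"
  obtains j y where "j \<in> {1..<n}" "y \<in> {1..n}" "\<sigma> y = j" "y \<noteq> Suc j"
proof (rule ccontr)
  assume "\<not> thesis"
  with that have *: "y = Suc j" if "j \<in> {1..<n}" "y \<in> {1..n}" "\<sigma> y = j" for j y
    using \<open>\<not> thesis\<close> that by blast
  have Suc: "\<sigma> (Suc j) = j" if j: "j \<in> {1..<n}" for j
  proof -
    have "j \<in> \<sigma> ` {1..n}" using permutes_image[OF assms(1)] j by auto
    then show ?thesis using *[OF j] by force
  qed
  have "\<sigma> i = CSL n n i" for i
  proof -
    consider "i \<notin> {1..n}" | "i \<in> {1..n}" "i \<noteq> 1" | "i = 1" "1 \<le> n" by force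
    then show ?thesis
    proof cases
      case 1
      then show ?thesis
        using permutes_not_in[OF assms(1)] by (auto simp: CSL_def)
    next
      case 2
      then have "i - 1 \<in> {1..<n}" by auto
      from Suc[OF this] show ?thesis
        using 2 by (simp add: CSL_def)
    next
      case 3
      then have "\<sigma> 1 \<in> {1..n}" using permutes_in_image[OF assms(1)] by auto
      moreover have "\<sigma> 1 \<notin> {1..<n}" using *[of "\<sigma> 1" 1] 3 by auto
      ultimately show ?thesis using 3 by (auto simp: CSL_def)
    qed
  qed
  then show False using assms(2) by blast
qed

section \<open>Injecting the good sets of \<open>CSL\<close> into those of \<open>S\<close>\<close>

lemma card_good_sets_less:
  assumes "n \<ge> 4" "inductive_strategy n S" "S n \<noteq> CSL n n"
  shows "card (good_sets n (CSL n)) < card (good_sets n S)"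
proof -
  have S: "is_strategy n S" "\<And>k. k \<in> {1..<n} \<Longrightarrow> S k = CS k" and cyc: "cyclic_on (S n) {1..n}"
    using assms(2) by (auto simp: inductive_strategy_def)
  have perm: "S n permutes {1..n}" using S(1) assms(1) by (simp add: is_strategy_def)
  have no_fix: "S n i \<noteq> i" and no_two: "S n (S n i) \<noteq> i" if "i \<in> {1..n}" for i
    using cyclic_on_no_short_cycle[OF cyc that] assms(1) by auto
  obtain h where h: "bij_betw h {1..n} {1..n}"
    and conj: "\<And>i. i \<in> {1..n} \<Longrightarrow> h (CS n i) = S n (h i)"
    using cyclic_on_conjugate_CS[OF cyc] assms(1) by auto
  obtain j y where jy: "j \<in> {1..<n}" "y \<in> {1..n}" "S n y = j" "y \<noteq> Suc j"
    using perm assms(3) by (rule exists_not_CSL)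
  define T where "T = {j, Suc j, y}"
  have T: "T \<in> good_sets n S" "card T = 3"
    unfolding T_def using good_sets_triple[OF S no_fix no_two assms(1) jy] by auto
  have fin: "finite (good_sets n S)"
    by (rule finite_subset[of _ "Pow {1..n}"]) (auto simp: good_sets_def)
  have inj: "inj_on ((`) h) (good_sets n (CSL n))"
    by (rule inj_on_subset[OF inj_on_image_Pow[OF bij_betw_imp_inj_on[OF h]]])
      (auto simp: good_sets_def)
  \<comment> \<open>The image of a proper good set is independent for \<open>S n\<close>, whereas
    \<open>T\<close> contains both \<open>y\<close> and \<open>S n y\<close>. The full set is its
    own image and is larger than \<open>T\<close>.\<close>
  have im: "h ` I \<in> good_sets n S - {T}" if good: "I \<in> good_sets n (CSL n)" for I
  proof (cases "I = {1..n}")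
    case True
    \<comment> \<open>On the full set e_I is \<open>S n\<close> itself, so goodness says that
      \<open>S n\<close> applied twice fixes nothing.\<close>
    have "{1..n} \<in> good_sets n S"
      using relabel_interval[OF perm] no_two assms(1) by (simp add: good_sets_def)
    moreover have "{1..n} \<noteq> T" using T(2) assms(1) by auto
    ultimately show ?thesis
      using True bij_betw_imp_surj_on[OF h] by simp
  next
    case False
    have I: "I \<subseteq> {1..n}" "2 \<le> card I" using good by (auto simp: good_sets_def)
    have hI: "h ` I \<subseteq> {1..n}" using I(1) bij_betw_imp_surj_on[OF h] by blast
    have "card (h ` I) = card I"
      by (rule card_image[OF inj_on_subset[OF bij_betw_imp_inj_on[OF h] I(1)]])
    have indep: "S n i \<notin> h ` I" if "i \<in> h ` I" for i
    proof
      assume "S n i \<in> h ` I"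
      obtain a where a: "a \<in> I" "i = h a" using \<open>i \<in> h ` I\<close> by blast
      have "a \<in> {1..n}" using a(1) I(1) by blast
      then have CS: "CS n a \<in> {1..n}" and "h (CS n a) \<in> h ` I"
        using permutes_in_image[OF CS_permutes] conj[of a] a(2) \<open>S n i \<in> h ` I\<close> by auto
      then have "CS n a \<in> I"
        using inj_on_image_mem_iff[OF bij_betw_imp_inj_on[OF h] CS I(1)] by blast
      then show False
        using good_sets_CSL[OF good False a(1)] by blast
    qed
    have "h ` I \<in> good_sets n S"
      using good_sets_independent[OF S(1) hI] indep no_fix I(2) \<open>card (h ` I) = card I\<close> by simp
    moreover have "h ` I \<noteq> T"
      using indep[of y] jy(3) by (auto simp: T_def)
    ultimately show ?thesis by blast
  qed
  have "card (good_sets n (CSL n)) \<le> card (good_sets n S - {T})"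
    using fin im by (intro card_inj_on_le[OF inj]) auto
  also have "\<dots> < card (good_sets n S)"
    using card_Diff1_less[OF fin T(1)] .
  finally show ?thesis .
qed

theorem theorem4p9:
  fixes n :: nat and S :: strategy
  assumes "n \<ge> 4"
    and "inductive_strategy n S"
    and "S n \<noteq> CSL n n"
  shows "fps_nth (wordle_gf n (CSL n)) 3 < fps_nth (wordle_gf n S) 3"
proof -
  have "is_strategy n (CSL n)"
    using CS_permutes CSL_permutes by (auto simp: is_strategy_def CSL_def)
  moreover have "CSL n k = CS k" if "k \<in> {1..<n}" for k
    using that by (simp add: CSL_def)
  moreover have "CSL n n i \<noteq> i" if "i \<in> {1..n}" for i
    using that assms(1) by (auto simp: CSL_def)
  moreover have "S n i \<noteq> i" if "i \<in> {1..n}" for i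
    using assms(1,2) that cyclic_on_no_short_cycle[of "S n" "{1..n}" i]
    by (auto simp: inductive_strategy_def)
  ultimately show ?thesis
    using assms card_good_sets_less[OF assms] wordle_gf_3[of n "CSL n"] wordle_gf_3[of n S]
    by (simp add: inductive_strategy_def)
qed

end
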